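(* Let $\mathcal{Y}\subset[0,\infty)$ be a finite set, let $P_{XY}$ be a probability distribution on $\mathcal{X}\times\mathcal{Y}$, and let $S_n=\{(x_1,y_1),\ldots,(x_n,y_n)\}$ where $(x_1,y_1),(x_2,y_2),\ldots$ are i.i.d. from $P_{XY}$. Let $D(r)=\frac{1}{\log(1+r)}$. Then for every ranking function $f:\mathcal{X}\to\mathbb{R}$, $$\mathrm{NDCG}_D(f,S_n)\to 1\quad\text{almost surely as } n\to\infty.$$
   Context: A ranking function is a measurable map $f:\mathcal{X}\to\mathbb{R}$. It orders $x_1,\ldots,x_n$ by decreasing score, giving $x^f_{(1)},\ldots,x^f_{(n)}$ with $f(x^f_{(1)})\ge\cdots\ge f(x^f_{(n)})$, ties being broken by a fixed rule not depending on the labels; $y^f_{(r)}$ denotes the label of $x^f_{(r)}$. For a discount function $D$, $\mathrm{DCG}_D(f,S_n)=\sum_{r=1}^n y^f_{(r)}D(r)$; $\mathrm{IDCG}_D(S_n)$ is the maximum of this sum over all orderings of the $n$ items (i.e. the value obtained when the labels are sorted in decreasing order); and $\mathrm{NDCG}_D(f,S_n)=\mathrm{DCG}_D(f,S_n)/\mathrm{IDCG}_D(S_n)$, with the convention that this equals $1$ when $\mathrm{IDCG}_D(S_n)=0$. $\log$ is the natural logarithm. *)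

theory Defs
  imports "HOL-Probability.Probability" "HOL-Combinatorics.Permutations"
begin

text \<open>
  A finite sample is a list of (item, label) pairs. An ordering of \<open>n\<close> items is a permutation
  \<open>\<pi>\<close> of \<open>{..<n}\<close>: the item with index \<open>\<pi> i\<close> is put at rank \<open>i + 1\<close>. Ranks start at 1, which is
  why the discount at position \<open>i\<close> is \<open>D (Suc i)\<close>.
\<close>

definition orders_by_score :: "('x \<Rightarrow> real) \<Rightarrow> 'x list \<Rightarrow> (nat \<Rightarrow> nat) \<Rightarrow> bool" where
  "orders_by_score f xs \<pi> \<longleftrightarrow>
     \<pi> permutes {..<length xs} \<and>
     (\<forall>i j. i \<le> j \<and> j < length xs \<longrightarrow> f (xs ! \<pi> i) \<ge> f (xs ! \<pi> j))"

text \<open>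
  A ranking rule chooses, for every ranking function and every finite list of items, an ordering by
  decreasing score; in particular it fixes how ties are broken. Labels are not among its arguments.
\<close>

definition ranking_rule :: "'x measure \<Rightarrow> (('x \<Rightarrow> real) \<Rightarrow> 'x list \<Rightarrow> nat \<Rightarrow> nat) \<Rightarrow> bool" where
  "ranking_rule N \<tau> \<longleftrightarrow>
     (\<forall>f \<in> borel_measurable N. \<forall>xs \<in> lists (space N). orders_by_score f xs (\<tau> f xs))"

definition ordered_gain :: "(nat \<Rightarrow> real) \<Rightarrow> ('x \<times> real) list \<Rightarrow> (nat \<Rightarrow> nat) \<Rightarrow> real" where
  "ordered_gain D S \<pi> = (\<Sum>i<length S. snd (S ! \<pi> i) * D (Suc i))"

definition DCG :: "(nat \<Rightarrow> real) \<Rightarrow> (('x \<Rightarrow> real) \<Rightarrow> 'x list \<Rightarrow> nat \<Rightarrow> nat) \<Rightarrow>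
    ('x \<Rightarrow> real) \<Rightarrow> ('x \<times> real) list \<Rightarrow> real" where
  "DCG D \<tau> f S = ordered_gain D S (\<tau> f (map fst S))"

definition IDCG :: "(nat \<Rightarrow> real) \<Rightarrow> ('x \<times> real) list \<Rightarrow> real" where
  "IDCG D S = Max (ordered_gain D S ` {\<pi>. \<pi> permutes {..<length S}})"

definition NDCG :: "(nat \<Rightarrow> real) \<Rightarrow> (('x \<Rightarrow> real) \<Rightarrow> 'x list \<Rightarrow> nat \<Rightarrow> nat) \<Rightarrow>
    ('x \<Rightarrow> real) \<Rightarrow> ('x \<times> real) list \<Rightarrow> real" where
  "NDCG D \<tau> f S = (if IDCG D S = 0 then 1 else DCG D \<tau> f S / IDCG D S)"

definition log_discount :: "nat \<Rightarrow> real" where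
  "log_discount r = 1 / ln (1 + real r)"

lemma orders_by_score_exists: "\<exists>\<pi>. orders_by_score f xs \<pi>"
proof -
  let ?n = "length xs"
  define js where "js = sort_key (\<lambda>i. - f (xs ! i)) [0..<?n]"
  define \<pi> where "\<pi> i = (if i < ?n then js ! i else i)" for i
  have len: "length js = ?n" and set: "set js = {..<?n}" and dist: "distinct js"
    by (auto simp: js_def)
  have "bij_betw (\<lambda>i. js ! i) {..<?n} {..<?n}"
    using bij_betw_nth[OF dist] len set by metis
  then have "bij_betw \<pi> {..<?n} {..<?n}"
    by (rule bij_betw_cong[THEN iffD1, rotated]) (simp add: \<pi>_def)
  then have "\<pi> permutes {..<?n}"
    by (rule bij_imp_permutes) (simp add: \<pi>_def)
  moreover have "sorted (map (\<lambda>i. - f (xs ! i)) js)"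
    by (simp add: js_def)
  then have "f (xs ! \<pi> i) \<ge> f (xs ! \<pi> j)" if "i \<le> j" "j < ?n" for i j
    using sorted_nth_mono[of "map (\<lambda>i. - f (xs ! i)) js" i j] that len by (simp add: \<pi>_def)
  ultimately show ?thesis
    by (auto simp: orders_by_score_def)
qed

lemma ranking_rule_exists: "\<exists>\<tau>. ranking_rule N \<tau>"
  unfolding ranking_rule_def using orders_by_score_exists by metis

end

theory Submission
  imports Defs "HOL-Probability.Hoeffding" "HOL-Real_Asymp.Real_Asymp"
begin

text \<open>
  The ranking is irrelevant: any permutation whatsoever has NDCG tending to 1. The logarithmic
  discount is so flat that \<open>(\<Sum>r\<le>n. D r) / (n * D n) \<longrightarrow> 1\<close>, so replacing every weight \<open>D r\<close> by
  \<open>D n\<close> changes the gain of an ordering with labels in \<open>[0, B]\<close> by at most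
  \<open>B * (\<Sum>r\<le>n. D r - D n)\<close>, which is of smaller order than \<open>n * D n\<close>. Once the label sum is at
  least \<open>c * n\<close> with \<open>c > 0\<close>, all orderings therefore have the same gain up to a factor tending
  to 1. If the mean label is positive, Hoeffding's inequality and the Borel-Cantelli lemma yield
  such a \<open>c\<close> almost surely; otherwise all labels vanish almost surely.
\<close>

section \<open>Growth of the sums of logarithmic discounts\<close>

lemma log_discount_pos: "r > 0 \<Longrightarrow> log_discount r > 0"
  by (simp add: log_discount_def)

lemma log_discount_antimono: "0 < r \<Longrightarrow> r \<le> s \<Longrightarrow> log_discount s \<le> log_discount r"
  by (auto simp: log_discount_def intro!: divide_left_mono mult_pos_pos)

text \<open>Ranks are split at a cut-off: at most \<open>K\<close> ranks lie below it, each with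
  discount at most \<open>1 / ln 2\<close>, and every later one has discount at most
  \<open>1 / ln (1 + K)\<close>. \<open>K\<close> stays free so that it can grow with
  \<open>n\<close>.\<close>

lemma sum_log_discount_le:
  assumes "K > 0"
  shows "(\<Sum>i<n. log_discount (Suc i)) \<le> K / ln 2 + real n / ln (1 + K)"
proof -
  have "(\<Sum>i<n. log_discount (Suc i)) \<le> (\<Sum>i<n. (if real (Suc i) \<le> K then 1 / ln 2 else 0) + 1 / ln (1 + K))"
  proof (intro sum_mono)
    fix i
    have "log_discount (Suc i) \<le> 1 / ln 2"
      using log_discount_antimono[of 1 "Suc i"] by (simp add: log_discount_def)
    moreover have "log_discount (Suc i) \<le> 1 / ln (1 + K)" if "K < real (Suc i)"
      using that assms by (auto simp: log_discount_def intro!: divide_left_mono mult_pos_pos)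
    moreover have "0 \<le> 1 / ln (1 + K)"
      using assms by simp
    ultimately show "log_discount (Suc i) \<le> (if real (Suc i) \<le> K then 1 / ln 2 else 0) + 1 / ln (1 + K)"
      by (smt (verit))
  qed
  also have "\<dots> = real (card {i\<in>{..<n}. real (Suc i) \<le> K}) / ln 2 + real n / ln (1 + K)"
    by (simp add: sum.distrib sum.If_cases Int_def)
  also have "\<dots> \<le> K / ln 2 + real n / ln (1 + K)"
  proof -
    have "card {i\<in>{..<n}. real (Suc i) \<le> K} \<le> card {..<nat \<lfloor>K\<rfloor>}"
    proof (intro card_mono subsetI)
      fix i assume "i \<in> {i \<in> {..<n}. real (Suc i) \<le> K}"
      then have "int (Suc i) \<le> \<lfloor>K\<rfloor>" by (simp add: le_floor_iff)
      then show "i \<in> {..<nat \<lfloor>K\<rfloor>}" by simp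
    qed simp
    then have "real (card {i\<in>{..<n}. real (Suc i) \<le> K}) \<le> K"
      using assms by simp linarith
    then show ?thesis by (simp add: divide_right_mono)
  qed
  finally show ?thesis .
qed

text \<open>This is the flatness of the logarithmic discount. A power \<open>r powr (-a)\<close>
  with 0 < a < 1 would give the limit 1 / (1 - a) instead.\<close>

lemma sum_log_discount_asymp:
  "(\<lambda>n. (\<Sum>i<n. log_discount (Suc i)) / (real n * log_discount n)) \<longlonglongrightarrow> 1"
proof (rule tendsto_sandwich)
  \<comment> \<open>This cut-off is \<open>o(n / ln n)\<close>, yet its logarithm is asymptotic to \<open>ln n\<close>.\<close>
  let ?K = "\<lambda>n. real n / ln (real n) ^ 2"
  show "\<forall>\<^sub>F n in sequentially. 1 \<le> (\<Sum>i<n. log_discount (Suc i)) / (real n * log_discount n)"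
    using eventually_gt_at_top[of 0]
  proof eventually_elim
    case (elim n)
    have "real n * log_discount n = (\<Sum>i<n. log_discount n)" by simp
    also have "\<dots> \<le> (\<Sum>i<n. log_discount (Suc i))"
      by (intro sum_mono log_discount_antimono) auto
    finally show ?case using elim log_discount_pos[of n] by simp
  qed
  show "\<forall>\<^sub>F n in sequentially. (\<Sum>i<n. log_discount (Suc i)) / (real n * log_discount n)
      \<le> (?K n / ln 2 + real n / ln (1 + ?K n)) / (real n * (1 / ln (1 + real n)))"
    \<comment> \<open>At \<open>n = 1\<close> the division by \<open>ln 1 = 0\<close> would make the
      cut-off 0, whereas it has to be positive.\<close>
    using eventually_gt_at_top[of 1]
  proof eventually_elim
    case (elim n)
    then have "?K n > 0" by simp
    from sum_log_discount_le[OF this, of n] elim show ?case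
      unfolding log_discount_def[of n] by (intro divide_right_mono) auto
  qed
  show "(\<lambda>n. (?K n / ln 2 + real n / ln (1 + ?K n)) / (real n * (1 / ln (1 + real n)))) \<longlonglongrightarrow> 1"
    by real_asymp
qed simp

section \<open>Gains of arbitrary orderings\<close>

lemma permutes_sum_nth:
  assumes "\<pi> permutes {..<length S}"
  shows "(\<Sum>i<length S. g (S ! \<pi> i)) = sum_list (map g S)"
  using sum.permute[OF assms, of "\<lambda>i. g (S ! i)"]
  by (simp add: sum_list_sum_nth o_def atLeast0LessThan)

lemma ordered_gain_ge:
  assumes "\<pi> permutes {..<length S}" and "\<And>z. z \<in> set S \<Longrightarrow> 0 \<le> snd z"
    and "\<And>i. i < length S \<Longrightarrow> d \<le> D (Suc i)"
  shows "sum_list (map snd S) * d \<le> ordered_gain D S \<pi>"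
proof -
  have "\<pi> i < length S" if "i < length S" for i
    using permutes_in_image[OF assms(1)] that by auto
  then show ?thesis
    unfolding ordered_gain_def permutes_sum_nth[OF assms(1), symmetric] sum_distrib_right
    using assms(2,3) by (intro sum_mono mult_left_mono) auto
qed

text \<open>The gain exceeds its value under the constant weight \<open>d\<close> by the sum of
  label times \<open>D (Suc i) - d\<close>. These differences are nonnegative, so each label may be
  replaced by \<open>B\<close>, which removes the dependence on \<open>\<pi>\<close>.\<close>

lemma ordered_gain_le:
  assumes "\<pi> permutes {..<length S}" and "\<And>z. z \<in> set S \<Longrightarrow> snd z \<le> B"
    and "\<And>i. i < length S \<Longrightarrow> d \<le> D (Suc i)"
  shows "ordered_gain D S \<pi>
    \<le> sum_list (map snd S) * d + B * ((\<Sum>i<length S. D (Suc i)) - real (length S) * d)"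
proof -
  have "\<pi> i < length S" if "i < length S" for i
    using permutes_in_image[OF assms(1)] that by auto
  then have "(\<Sum>i<length S. snd (S ! \<pi> i) * (D (Suc i) - d)) \<le> (\<Sum>i<length S. B * (D (Suc i) - d))"
    using assms(2,3) by (intro sum_mono mult_right_mono) auto
  then show ?thesis
    unfolding ordered_gain_def permutes_sum_nth[OF assms(1), symmetric]
    by (simp add: algebra_simps sum_subtractf sum_distrib_left)
qed

lemma IDCG_ge:
  assumes "\<pi> permutes {..<length S}"
  shows "ordered_gain D S \<pi> \<le> IDCG D S"
  unfolding IDCG_def using assms by (intro Max_ge) (auto simp: finite_permutations)

lemma IDCG_attained:
  obtains \<pi> where "\<pi> permutes {..<length S}" and "IDCG D S = ordered_gain D S \<pi>"
proof -
  have "IDCG D S \<in> ordered_gain D S ` {\<pi>. \<pi> permutes {..<length S}}"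
    unfolding IDCG_def by (intro Max_in) (auto simp: finite_permutations intro!: exI[of _ id] permutes_id)
  then show ?thesis using that by auto
qed

text \<open>Every ordering has gain 0, so the convention for a vanishing \<open>IDCG\<close>
  applies.\<close>

lemma NDCG_zero_labels:
  assumes "\<And>z. z \<in> set S \<Longrightarrow> snd z = 0"
  shows "NDCG D \<tau> f S = 1"
proof -
  obtain \<pi> where \<pi>: "\<pi> permutes {..<length S}" "IDCG D S = ordered_gain D S \<pi>"
    by (rule IDCG_attained)
  have "\<pi> i < length S" if "i < length S" for i
    using permutes_in_image[OF \<pi>(1)] that by auto
  then have "IDCG D S = 0"
    using assms by (simp add: \<pi>(2) ordered_gain_def)
  then show ?thesis by (simp add: NDCG_def)
qed

text \<open>\<open>DCG\<close> and \<open>IDCG\<close> both lie between \<open>?T * d\<close> and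
  \<open>?T * d + B * ?e\<close>. The linear lower bound on \<open>?T\<close> turns this additive
  error into a relative one, so the lower bound on \<open>NDCG\<close> sees the sample only through
  its length.\<close>

lemma NDCG_bounds:
  assumes perm: "\<tau> f (map fst S) permutes {..<length S}"
    and labels: "\<And>z. z \<in> set S \<Longrightarrow> 0 \<le> snd z \<and> snd z \<le> B"
    and d: "0 < d" "\<And>i. i < length S \<Longrightarrow> d \<le> D (Suc i)"
    and c: "0 < c" "c * real (length S) \<le> sum_list (map snd S)" and "S \<noteq> []"
  shows "1 / (1 + B / c * ((\<Sum>i<length S. D (Suc i)) / (real (length S) * d) - 1)) \<le> NDCG D \<tau> f S"
    and "NDCG D \<tau> f S \<le> 1"
proof -
  let ?T = "sum_list (map snd S)" and ?n = "real (length S)"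
  let ?e = "(\<Sum>i<length S. D (Suc i)) - ?n * d"
  have n: "?n > 0" using \<open>S \<noteq> []\<close> by simp
  then have T: "?T > 0" using c mult_pos_pos[of c ?n] by linarith
  have B: "B \<ge> 0" using labels \<open>S \<noteq> []\<close> by (meson hd_in_set order_trans)
  have "(\<Sum>i<length S. d) \<le> (\<Sum>i<length S. D (Suc i))"
    using d(2) by (intro sum_mono) auto
  then have e: "?e \<ge> 0" by simp
  have ge: "?T * d \<le> DCG D \<tau> f S"
    unfolding DCG_def using perm labels d by (intro ordered_gain_ge) auto
  have le: "DCG D \<tau> f S \<le> IDCG D S"
    unfolding DCG_def using perm by (rule IDCG_ge)
  have pos: "0 < DCG D \<tau> f S" using ge T d(1) mult_pos_pos[of ?T d] by linarith
  then have NDCG: "NDCG D \<tau> f S = DCG D \<tau> f S / IDCG D S"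
    using le by (simp add: NDCG_def)
  show "NDCG D \<tau> f S \<le> 1" using le pos by (simp add: NDCG)
  obtain \<pi> where \<pi>: "\<pi> permutes {..<length S}" "IDCG D S = ordered_gain D S \<pi>"
    by (rule IDCG_attained)
  have "IDCG D S \<le> ?T * d + B * ?e"
    unfolding \<pi>(2) using \<pi>(1) labels d by (intro ordered_gain_le) auto
  \<comment> \<open>The factor \<open>?T / (c * ?n)\<close> is at least 1; inserting it lets
    \<open>?T * d\<close> be factored out.\<close>
  also have "\<dots> \<le> ?T * d + B * ?e * (?T / (c * ?n))"
    using mult_left_mono[of 1 "?T / (c * ?n)" "B * ?e"] B e c n by (simp add: le_divide_eq)
  also have "?T * d + B * ?e * (?T / (c * ?n)) = ?T * d * (1 + B / c * (?e / (?n * d)))"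
    using c(1) d(1) n by (simp add: divide_simps) (simp add: algebra_simps)
  also have "\<dots> \<le> DCG D \<tau> f S * (1 + B / c * (?e / (?n * d)))"
    using ge B c(1) e d(1) n by (intro mult_right_mono add_nonneg_nonneg mult_nonneg_nonneg) auto
  also have "?e / (?n * d) = (\<Sum>i<length S. D (Suc i)) / (?n * d) - 1"
    using n d(1) by (simp add: diff_divide_distrib)
  finally have main: "IDCG D S
    \<le> DCG D \<tau> f S * (1 + B / c * ((\<Sum>i<length S. D (Suc i)) / (?n * d) - 1))" (is "_ \<le> _ * ?q") .
  then have "0 < DCG D \<tau> f S * ?q" using pos le by linarith
  then have "0 < ?q" using pos by (simp add: zero_less_mult_iff)
  then show "1 / ?q \<le> NDCG D \<tau> f S"
    using main pos le by (simp add: NDCG field_simps)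
qed

text \<open>A statement about one fixed sequence of samples; randomness enters later, only through
  the existence of \<open>c\<close>.\<close>

lemma NDCG_log_discount_tendsto:
  fixes z :: "nat \<Rightarrow> 'x \<times> real"
  assumes perm: "\<And>n. \<tau> f (map fst (map z [0..<n])) permutes {..<n}"
    and labels: "\<And>i. 0 \<le> snd (z i) \<and> snd (z i) \<le> B"
    and c: "0 < c" "\<forall>\<^sub>F n in sequentially. c * real n \<le> (\<Sum>i<n. snd (z i))"
  shows "(\<lambda>n. NDCG log_discount \<tau> f (map z [0..<n])) \<longlonglongrightarrow> 1"
proof (rule tendsto_sandwich)
  let ?r = "\<lambda>n. (\<Sum>i<n. log_discount (Suc i)) / (real n * log_discount n)"
  have labels': "0 \<le> snd w \<and> snd w \<le> B" if "w \<in> set (map z [0..<n])" for w n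
    using labels that by auto
  \<comment> \<open>Here \<open>d = log_discount n\<close>, the smallest of the first
    \<open>n\<close> weights. It is positive only for \<open>n > 0\<close>, since
    \<open>log_discount 0 = 1 / ln 1 = 0\<close>.\<close>
  have bounds: "1 / (1 + B / c * (?r n - 1)) \<le> NDCG log_discount \<tau> f (map z [0..<n])"
      "NDCG log_discount \<tau> f (map z [0..<n]) \<le> 1"
    if n: "0 < n" "c * real n \<le> (\<Sum>i<n. snd (z i))" for n
    using NDCG_bounds[of \<tau> f "map z [0..<n]" B "log_discount n" log_discount c, OF _ labels']
      perm[of n] n c(1) log_discount_pos log_discount_antimono
    by (auto simp: o_def sum_list_sum_nth atLeast0LessThan)
  show "\<forall>\<^sub>F n in sequentially. 1 / (1 + B / c * (?r n - 1)) \<le> NDCG log_discount \<tau> f (map z [0..<n])"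
    using c(2) eventually_gt_at_top[of 0] by eventually_elim (rule bounds)
  show "\<forall>\<^sub>F n in sequentially. NDCG log_discount \<tau> f (map z [0..<n]) \<le> 1"
    using c(2) eventually_gt_at_top[of 0] by eventually_elim (rule bounds)
  have "(\<lambda>n. 1 / (1 + B / c * (?r n - 1))) \<longlonglongrightarrow> 1 / (1 + B / c * (1 - 1))"
    by (intro tendsto_intros sum_log_discount_asymp) auto
  then show "(\<lambda>n. 1 / (1 + B / c * (?r n - 1))) \<longlonglongrightarrow> 1" by simp
qed simp

section \<open>Almost sure behaviour of the label sums\<close>

lemma (in prob_space) iid_bounded_sum_ge_linear:
  fixes X :: "nat \<Rightarrow> 'a \<Rightarrow> real"
  assumes indep: "indep_vars (\<lambda>_. borel) X UNIV"
    and distr: "\<And>i. distr M borel (X i) = distr M borel (X 0)"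
    and bounded: "AE \<omega> in M. X 0 \<omega> \<in> {a..b}"
    and c: "c < expectation (X 0)"
  shows "AE \<omega> in M. \<forall>\<^sub>F n in sequentially. c * real n \<le> (\<Sum>i<n. X i \<omega>)"
proof -
  have [measurable]: "X i \<in> borel_measurable M" for i
    using indep by (auto simp: indep_vars_def)
  define \<delta> where "\<delta> = expectation (X 0) - c"
  \<comment> \<open>Widening the interval keeps its length positive even if \<open>a = b\<close>, so
    that the exponent below is meaningful.\<close>
  define b' where "b' = max b (a + 1)"
  have ab': "a < b'" by (simp add: b'_def)
  \<comment> \<open>Hoeffding's bound for a deviation of \<open>\<delta>\<close> from the mean is
    the \<open>n\<close>-th power of this number, so the probabilities are dominated by a geometric
    series.\<close>
  define q where "q = exp (-2 * \<delta>\<^sup>2 / (b' - a)\<^sup>2)"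
  define E where "E n = {\<omega> \<in> space M. (\<Sum>i<n. X i \<omega>) / n \<le> expectation (X 0) - \<delta>}" for n
  have prob_E: "prob (E n) \<le> q ^ n" if "n > 0" for n
  proof -
    interpret Hoeffding_ineq_iid M "{..<n}" X "X 0" a b' "expectation (X 0)"
    proof unfold_locales
      show "indep_vars (\<lambda>_. borel) X {..<n}"
        using indep by (rule indep_vars_subset) simp
      show "AE x in M. X 0 x \<in> {a..b'}"
        using bounded by eventually_elim (auto simp: b'_def)
    qed (rule distr | simp)+
    \<comment> \<open>\<open>expectation_X\<close> loops here because \<open>X 0\<close> is also the reference variable of the locale.\<close>
    have "prob (E n) \<le> exp (-2 * real n * \<delta>\<^sup>2 / (b' - a)\<^sup>2)"
      using Hoeffding_ineq_le'[of \<delta>] that c ab' by (auto simp: E_def \<delta>_def simp del: expectation_X)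
    also have "\<dots> = q ^ n"
      by (simp add: q_def exp_of_nat_mult[symmetric] mult_ac)
    finally show ?thesis .
  qed
  have "summable (\<lambda>n. prob (E n))"
  proof (rule summable_comparison_test_ev)
    show "\<forall>\<^sub>F n in sequentially. norm (prob (E n)) \<le> q ^ n"
      using eventually_gt_at_top[of 0] by eventually_elim (use prob_E in auto)
    have "\<bar>q\<bar> < 1" using c ab' by (simp add: q_def \<delta>_def)
    then show "summable (\<lambda>n. q ^ n)" by (simp add: summable_geometric)
  qed
  moreover have "E n \<in> events" for n unfolding E_def by measurable
  ultimately have "AE \<omega> in M. \<forall>\<^sub>F n in sequentially. \<omega> \<in> space M - E n"
    by (intro borel_cantelli_AE1) (auto simp: emeasure_eq_measure)
  then show ?thesis
  proof eventually_elim
    case (elim \<omega>)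
    then show ?case using eventually_gt_at_top[of 0]
      by eventually_elim (auto simp: E_def \<delta>_def field_simps)
  qed
qed

theorem theorem1:
  fixes N :: "'x measure" and \<Y> :: "real set" and P :: "('x \<times> real) measure"
    and M :: "'w measure" and Z :: "nat \<Rightarrow> 'w \<Rightarrow> 'x \<times> real"
    and \<tau> :: "('x \<Rightarrow> real) \<Rightarrow> 'x list \<Rightarrow> nat \<Rightarrow> nat" and f :: "'x \<Rightarrow> real"
  assumes "finite \<Y>" and "\<Y> \<subseteq> {0..}"
    and "prob_space P" and "sets P = sets (N \<Otimes>\<^sub>M count_space \<Y>)"
    and "prob_space M"
    and "prob_space.indep_vars M (\<lambda>_. P) Z UNIV"
    and "\<And>i. distr M P (Z i) = P"
    and "ranking_rule N \<tau>"
    and "f \<in> borel_measurable N"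
  shows "AE \<omega> in M.
    (\<lambda>n. NDCG log_discount \<tau> f (map (\<lambda>i. Z i \<omega>) [0..<n])) \<longlonglongrightarrow> 1"
proof -
  interpret P: prob_space P by fact
  interpret prob_space M by fact
  have Z [measurable]: "Z i \<in> measurable M P" for i
    using assms(6) by (auto simp: indep_vars_def)
  have space_P: "space P = space N \<times> \<Y>"
    using sets_eq_imp_space_eq[OF assms(4)] by (simp add: space_pair_measure)
  have snd [measurable]: "snd \<in> borel_measurable P"
  proof -
    have "snd \<in> measurable P (count_space \<Y>)"
      using assms(4) by (simp cong: measurable_cong_sets)
    from measurable_compose[OF this, of "\<lambda>y. y" borel] show ?thesis by simp
  qed
  define X where "X = (\<lambda>i \<omega>. snd (Z i \<omega>))"
  have [measurable]: "X i \<in> borel_measurable M" for i unfolding X_def by measurable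
  obtain B where B: "y \<le> B" if "y \<in> \<Y>" for y
    using finite_imp_bounded[OF assms(1)] bounded_imp_bdd_above unfolding bdd_above_def by metis
  \<comment> \<open>These hold at every sample point, not just almost everywhere, because a
    measurable map sends \<open>space M\<close> into \<open>space P\<close>.\<close>
  have Z_space: "fst (Z i \<omega>) \<in> space N" "X i \<omega> \<in> \<Y>" if "\<omega> \<in> space M" for i \<omega>
    using measurable_space[OF Z that, of i] space_P by (auto simp: X_def mem_Times_iff)
  have X_bounds: "0 \<le> X i \<omega>" "X i \<omega> \<le> B" if "\<omega> \<in> space M" for i \<omega>
    using Z_space(2)[OF that, of i] assms(2) B by auto
  have perm: "\<tau> f (map fst (map (\<lambda>i. Z i \<omega>) [0..<n])) permutes {..<n}" if "\<omega> \<in> space M" for \<omega> n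
  proof -
    have "map fst (map (\<lambda>i. Z i \<omega>) [0..<n]) \<in> lists (space N)"
      using Z_space(1)[OF that] by auto
    with assms(8,9) have "orders_by_score f (map fst (map (\<lambda>i. Z i \<omega>) [0..<n]))
        (\<tau> f (map fst (map (\<lambda>i. Z i \<omega>) [0..<n])))"
      unfolding ranking_rule_def by blast
    then show ?thesis by (simp add: orders_by_score_def)
  qed
  have distr: "distr M borel (X i) = distr P borel snd" for i
    using distr_distr[OF snd Z[of i]] assms(7)[of i] by (simp add: o_def X_def)
  have indep: "indep_vars (\<lambda>_. borel) X UNIV"
    unfolding X_def using assms(6) by (rule indep_vars_compose2) simp
  have bounded: "AE \<omega> in M. X 0 \<omega> \<in> {0..B}"
    using X_bounds by (auto intro!: AE_I2)
  show ?thesis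
  \<comment> \<open>A positive \<open>c\<close> below the mean exists only if the mean is positive,
    hence the separate treatment of mean 0.\<close>
  proof (cases "expectation (X 0) = 0")
    case True
    have "integrable M (X 0)"
      by (rule integrable_const_bound[of _ B]) (use X_bounds in \<open>auto intro!: AE_I2\<close>)
    with True have "AE \<omega> in M. X 0 \<omega> = 0"
      using X_bounds by (subst (asm) integral_nonneg_eq_0_iff_AE) (auto intro!: AE_I2)
    \<comment> \<open>Vanishing is restated as a property of the law, which all labels share, and is
      thereby carried from \<open>X 0\<close> to every \<open>X i\<close>.\<close>
    then have "AE y in distr M borel (X 0). y = 0"
      by (simp add: AE_distr_iff)
    then have "AE \<omega> in M. X i \<omega> = 0" for i
      unfolding distr[of 0] distr[of i, symmetric] by (simp add: AE_distr_iff)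
    then have "AE \<omega> in M. \<forall>i. X i \<omega> = 0"
      by (simp add: AE_all_countable)
    then show ?thesis
    proof eventually_elim
      case (elim \<omega>)
      then have "NDCG log_discount \<tau> f (map (\<lambda>i. Z i \<omega>) [0..<n]) = 1" for n
        by (intro NDCG_zero_labels) (auto simp: X_def)
      then show ?case by simp
    qed
  next
    case False
    moreover have "expectation (X 0) \<ge> 0"
      using X_bounds by (intro Bochner_Integration.integral_nonneg) auto
    ultimately have \<mu>: "expectation (X 0) > 0" by simp
    \<comment> \<open>Any value strictly between 0 and the mean would do.\<close>
    define c where "c = expectation (X 0) / 2"
    have c: "0 < c" "c < expectation (X 0)" using \<mu> by (simp_all add: c_def)
    have "AE \<omega> in M. \<forall>\<^sub>F n in sequentially. c * real n \<le> (\<Sum>i<n. X i \<omega>)"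
      using indep _ bounded c(2) by (rule iid_bounded_sum_ge_linear) (simp add: distr)
    with AE_space show ?thesis
    proof eventually_elim
      case (elim \<omega>)
      then show ?case
        using perm X_bounds c(1) unfolding X_def
        by (intro NDCG_log_discount_tendsto[where B = B and c = c]) auto
    qed
  qed
qed

end
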